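(* Consider an execution, with eventual message delay $\delta$, of the SMR synchronizer algorithm described in the context, in which every correct process eventually attempts to advance from view $0$ unless it enters a view $>0$ (i.e. $T_i(0)$ is defined for every $p_i\in\mathcal C$). Let $$\mathcal V=\max\{v \mid (E_{\rm first}(v)\text{ is defined and } E_{\rm first}(v)<\mathsf{GST}+\rho)\ \text{or}\ v=0\}+1$$ if $A_{\rm first}(0)<\mathsf{GST}$, and $\mathcal V=1$ otherwise. Then the following hold. 1. (Monotonicity) For all correct $p_i$ and views $v,v'$: if $E_i(v)$ and $E_i(v')$ are defined, then $v<v' \iff E_i(v)<E_i(v')$. 2. (Validity) For all correct $p_i$ and $v\ge 0$: if $E_i(v+1)$ is defined, then $A_{\rm first}(v)$ is defined and $A_{\rm first}(v)<E_i(v+1)$. 3. (Bounded Entry, for $d=2\delta$ and for $\mathcal V$ equal to $\max\{v \mid (E_{\rm first}(v)\text{ is defined and } E_{\rm first}(v)<\mathsf{GST}+\rho)\ \text{or}\ v=0\}+1$ if $A_{\rm first}(0)<\mathsf{GST}$, and equal to $1$ otherwise) For all $v\ge\mathcal V$: if $E_{\rm first}(v)$ is defined and it is not the case that $A_{\rm first}(v)$ is defined with $A_{\rm first}(v)<E_{\rm first}(v)+2\delta$, then $E_i(v)$ is defined for every correct $p_i$ and $E_{\rm last}(v)\le E_{\rm first}(v)+2\delta$. 4. (Startup) If there is a set $P$ of $f+1$ correct processes such that $A_i(0)$ is defined for all $p_i\in P$, then $E_{\rm first}(1)$ is defined. 5. (Progress) For all views $v$: if $E_{\rm first}(v)$ is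 defined and there is a set $P$ of $f+1$ correct processes such that for all $p_i\in P$, $E_i(v)$ defined implies $A_i(v)$ defined, then $E_{\rm first}(v+1)$ is defined. Furthermore: A. For all views $v$: if $E_{\rm first}(v)$ is defined and $A_{\rm first}(0)<\mathsf{GST}$, then $E_{\rm last}(v)\le\max(E_{\rm first}(v),\mathsf{GST}+\rho)+2\delta$. B. For all $v\ge 0$: if $E_{\rm first}(v+1)$ is defined, then $E_{\rm last}(v+1)\le\max(T_{\rm last}(v),\mathsf{GST}+\rho)+\delta$ if $A_{\rm first}(0)<\mathsf{GST}$, and $E_{\rm last}(v+1)\le T_{\rm last}(v)+\delta$ otherwise.
   Context: Model. There are $n=3f+1$ processes $p_1,\dots,p_n$; at most $f$ are Byzantine (arbitrary behavior), the others are correct, and $\mathcal C$ is the set of correct processes. Links are authenticated and point-to-point. Partial synchrony: each execution has a time $\mathsf{GST}$ and a duration $\delta$ (unknown to the protocol) such that messages sent between correct processes after $\mathsf{GST}$ are received within $\delta$; before $\mathsf{GST}$ messages can be arbitrarily delayed or lost. Local clocks may drift arbitrarily before $\mathsf{GST}$ and do not drift (track real time) thereafter. Local steps take no time. SMR synchronizer interface. Views are $1,2,\dots$; $0$ is an invalid initial view in which every process starts. The synchronizer issues notifications $\mathtt{new\_view}(v)$ at a process, telling it to enter $v$. A process can call $\mathtt{advance}()$ to signal that it wishes to move to a higher view; a correct process never calls $\mathtt{advance}$ twice without an intervening $\mathtt{new\_view}$ notification. A process "attempts to advance from $v$" when it calls $\mathtt{advance}$ while the last view it entered is $v$ ($v=0$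 if none). Notation. For a correct $p_i$: $E_i(v)$ is the time when $p_i$ enters $v$ (if it does); $E_{\rm first}(v)$, $E_{\rm last}(v)$ are the earliest and latest times when some correct process enters $v$. $A_i(v)$ is the time when $p_i$ attempts to advance from $v$; $A_{\rm first}(v)$ is the earliest such time over correct processes. Given a view $v$ that was entered by a correct process $p_i$ (view $0$ being the initial view of all processes), $T_i(v)$ is the time at which $p_i$ either attempts to advance from $v$ or enters a view $>v$; $T_{\rm last}(v)$ is the latest time when a correct process does so. All these are partial functions. Algorithm (code for a process). Variables: array $\mathsf{max\_views}[1..n]$, $\mathsf{view}$, $\mathsf{view}^+$, all initially $0$; boolean $\mathsf{advanced}$, initially false. Parameter $\rho>0$. - On $\mathtt{advance}()$: send $\mathtt{WISH}(\max(\mathsf{view}+1,\mathsf{view}^+))$ to all processes (including itself); set $\mathsf{advanced}$ to true. - Periodically, every $\rho$ time units of the local clock: if $\mathsf{advanced}$, send $\mathtt{WISH}(\max(\mathsf{view}+1,\mathsf{view}^+))$ to all; else if $\mathsf{view}^+>0$, send $\mathtt{WISH}(\mathsf{view}^+)$ to all. - On receiving $\mathtt{WISH}(v)$ from $p_j$: save the old values $prev\_v:=\mathsf{view}$, $prev\_v^+:=\mathsf{view}^+$; if $v>\mathsf{max\_views}[j]$, set $\mathsf{max\_views}[j]:=v$; set $\mathsf{view}$ to the largest entry $v'$ of $\mathsf{max\_views}$ such that at least $2f+1$ entries are $\ge v'$, and $\mathsf{view}^+$ to the largest entry $v'$ such that at least $f+1$ entries are $\ge v'$; if $\mathsf{view}^+=\mathsf{view}$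 and $\mathsf{view}>prev\_v$, trigger $\mathtt{new\_view}(\mathsf{view})$ (the process enters $\mathsf{view}$) and set $\mathsf{advanced}$ to false; then if $\mathsf{view}^+>prev\_v^+$, send $\mathtt{WISH}(\mathsf{view}^+)$ to all.
   Formalization: Every message between correct processes takes positive time and a correct process receives messages at distinct times (strict inequalities fail otherwise); T_last(v) ranges over all correct processes, including those that skipped v, and is defined only if each of them leaves v. *)

theory Defs
  imports Complex_Main
begin

section \<open>The algorithm\<close>

text \<open>
  Processes are the elements of a finite type \<open>'p\<close> (with \<open>3 * f + 1\<close> elements, see
  \<open>synchronizer_execution\<close> below); views are natural numbers, \<open>0\<close> being the invalid initial view.
\<close>

record 'p local_state =
  max_views :: "'p \<Rightarrow> nat"
  view :: nat
  view_plus :: nat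
  advanced :: bool

definition init_state :: "'p local_state" where
  "init_state = \<lparr>max_views = (\<lambda>_. 0), view = 0, view_plus = 0, advanced = False\<rparr>"

definition largest_supported :: "nat \<Rightarrow> ('p::finite \<Rightarrow> nat) \<Rightarrow> nat" where
  "largest_supported k m = Max {v \<in> range m. k \<le> card {j. v \<le> m j}}"

text \<open>
  A handler returns the new state, the view of the \<open>new_view\<close> notification it triggers (if any)
  and the view \<open>v\<close> of the message \<open>WISH(v)\<close> it sends to all processes, itself included (if any).
  No handler triggers more than one notification or broadcasts more than once.
\<close>

type_synonym 'p outcome = "'p local_state \<times> nat option \<times> nat option"

definition wish_view :: "'p local_state \<Rightarrow> nat" where
  "wish_view s = max (view s + 1) (view_plus s)"

definition on_advance :: "'p local_state \<Rightarrow> 'p outcome" where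
  "on_advance s = (s\<lparr>advanced := True\<rparr>, None, Some (wish_view s))"

definition on_timer :: "'p local_state \<Rightarrow> 'p outcome" where
  "on_timer s =
     (s, None,
      if advanced s then Some (wish_view s)
      else if 0 < view_plus s then Some (view_plus s)
      else None)"

definition on_wish :: "nat \<Rightarrow> 'p::finite \<Rightarrow> nat \<Rightarrow> 'p local_state \<Rightarrow> 'p outcome" where
  "on_wish f j v s =
     (let m = (if max_views s j < v then (max_views s)(j := v) else max_views s);
          w = largest_supported (2 * f + 1) m;
          wp = largest_supported (f + 1) m;
          enter = (wp = w \<and> view s < w)
      in (\<lparr>max_views = m, view = w, view_plus = wp,
            advanced = (if enter then False else advanced s)\<rparr>,
          if enter then Some w else None,
          if view_plus s < wp then Some wp else None))"

section \<open>Traces and runs\<close>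

text \<open>
  \<open>Recv i j v\<close>: process \<open>i\<close> receives \<open>WISH(v)\<close> from \<open>j\<close>; \<open>Timer i\<close>: the periodic handler of \<open>i\<close>
  is executed; \<open>Advance i\<close>: \<open>advance()\<close> is called at \<open>i\<close>.
\<close>

datatype 'p event = Recv 'p 'p nat | Timer 'p | Advance 'p

text \<open>
  A trace lists all steps in the order in which they are taken, with their real times. Steps are
  instantaneous, so several of them may carry the same time. If step \<open>n\<close> is the receipt of a
  message from a correct process, \<open>origin n\<close> is the step in which that message was sent. Steps of
  Byzantine processes may or may not be listed; nothing below looks at them.
\<close>

record 'p trace =
  event :: "nat \<Rightarrow> 'p event"
  time :: "nat \<Rightarrow> real"
  origin :: "nat \<Rightarrow> nat"
  clock :: "'p \<Rightarrow> real \<Rightarrow> real"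

definition step :: "nat \<Rightarrow> 'p::finite \<Rightarrow> 'p event \<Rightarrow> 'p local_state \<Rightarrow> 'p outcome" where
  "step f i e s =
     (case e of
        Recv i' j v \<Rightarrow> if i' = i then on_wish f j v s else (s, None, None)
      | Timer i' \<Rightarrow> if i' = i then on_timer s else (s, None, None)
      | Advance i' \<Rightarrow> if i' = i then on_advance s else (s, None, None))"

primrec state_at :: "nat \<Rightarrow> 'p::finite trace \<Rightarrow> 'p \<Rightarrow> nat \<Rightarrow> 'p local_state" where
  "state_at f X i 0 = init_state"
| "state_at f X i (Suc n) = fst (step f i (event X n) (state_at f X i n))"

definition new_view :: "nat \<Rightarrow> 'p::finite trace \<Rightarrow> 'p \<Rightarrow> nat \<Rightarrow> nat option" where
  "new_view f X i n = fst (snd (step f i (event X n) (state_at f X i n)))"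

definition sends :: "nat \<Rightarrow> 'p::finite trace \<Rightarrow> 'p \<Rightarrow> nat \<Rightarrow> nat option" where
  "sends f X i n = snd (snd (step f i (event X n) (state_at f X i n)))"

text \<open>
  The last view entered strictly before step \<open>n\<close>. This is not the variable \<open>view\<close>, which can also
  grow without a notification.
\<close>

primrec last_entered :: "nat \<Rightarrow> 'p::finite trace \<Rightarrow> 'p \<Rightarrow> nat \<Rightarrow> nat" where
  "last_entered f X i 0 = 0"
| "last_entered f X i (Suc n) =
     (case new_view f X i n of None \<Rightarrow> last_entered f X i n | Some v \<Rightarrow> v)"

section \<open>Executions\<close>

text \<open>
  Real time is non-negative, and only finitely many steps are taken in bounded time. A correct
  process handles one message at a time: its receipts have distinct times.
\<close>

definition timing :: "'p set \<Rightarrow> 'p trace \<Rightarrow> bool" where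
  "timing C X \<longleftrightarrow>
     0 \<le> time X 0 \<and> mono (time X) \<and> filterlim (time X) at_top sequentially \<and>
     (\<forall>i\<in>C. \<forall>n m j j' v v'. n < m \<longrightarrow> event X n = Recv i j v \<longrightarrow> event X m = Recv i j' v' \<longrightarrow>
        time X n < time X m)"

text \<open>
  Authenticated links between correct processes: only messages that were sent are received, and
  every message takes positive time. Messages sent from \<open>GST\<close> on are received within \<open>\<delta>\<close>;
  earlier ones may be delayed arbitrarily or lost. Receipts from Byzantine processes are not
  constrained.
\<close>

definition links :: "nat \<Rightarrow> 'p::finite set \<Rightarrow> real \<Rightarrow> real \<Rightarrow> 'p trace \<Rightarrow> bool" where
  "links f C GST \<delta> X \<longleftrightarrow>
     (\<forall>i\<in>C. \<forall>j\<in>C. \<forall>n v. event X n = Recv i j v \<longrightarrow>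
        sends f X j (origin X n) = Some v \<and> time X (origin X n) < time X n) \<and>
     (\<forall>i\<in>C. \<forall>j\<in>C. \<forall>m v. sends f X j m = Some v \<longrightarrow> GST \<le> time X m \<longrightarrow>
        (\<exists>n. event X n = Recv i j v \<and> origin X n = m \<and> time X n \<le> time X m + \<delta>))"

text \<open>
  A local clock never runs backwards, is otherwise arbitrary before \<open>GST\<close>, and measures real time
  from \<open>GST\<close> on.
\<close>

definition local_clocks :: "'p set \<Rightarrow> real \<Rightarrow> 'p trace \<Rightarrow> bool" where
  "local_clocks C GST X \<longleftrightarrow>
     (\<forall>i\<in>C. mono_on {0..} (clock X i) \<and>
        (\<forall>s t. GST \<le> s \<longrightarrow> s \<le> t \<longrightarrow> clock X i t - clock X i s = t - s))"

text \<open>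
  The periodic handler is executed when the local clock shows \<open>c\<close>, \<open>c + \<rho>\<close>, \<open>c + 2 * \<rho>\<close> and so on,
  where the phase \<open>c\<close> lies within one period of the initial clock value.
\<close>

definition periodic :: "'p set \<Rightarrow> real \<Rightarrow> 'p trace \<Rightarrow> bool" where
  "periodic C \<rho> X \<longleftrightarrow>
     (\<forall>i\<in>C. \<exists>c tick. clock X i 0 \<le> c \<and> c \<le> clock X i 0 + \<rho> \<and>
        strict_mono (tick :: nat \<Rightarrow> nat) \<and> range tick = {n. event X n = Timer i} \<and>
        (\<forall>k. clock X i (time X (tick k)) = c + real k * \<rho>))"

definition advance_discipline :: "nat \<Rightarrow> 'p::finite set \<Rightarrow> 'p trace \<Rightarrow> bool" where
  "advance_discipline f C X \<longleftrightarrow>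
     (\<forall>i\<in>C. \<forall>n m. n < m \<longrightarrow> event X n = Advance i \<longrightarrow> event X m = Advance i \<longrightarrow>
        (\<exists>k. n < k \<and> k < m \<and> new_view f X i k \<noteq> None))"

definition synchronizer_execution ::
  "nat \<Rightarrow> 'p::finite set \<Rightarrow> real \<Rightarrow> real \<Rightarrow> real \<Rightarrow> 'p trace \<Rightarrow> bool" where
  "synchronizer_execution f C GST \<delta> \<rho> X \<longleftrightarrow>
     card (UNIV :: 'p set) = 3 * f + 1 \<and> card (- C) \<le> f \<and> 0 \<le> GST \<and> 0 < \<delta> \<and> 0 < \<rho> \<and>
     timing C X \<and> links f C GST \<delta> X \<and> local_clocks C GST X \<and> periodic C \<rho> X \<and>
     advance_discipline f C X"

section \<open>Times of entering and leaving views\<close>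

text \<open>
  Partial functions are rendered with \<^typ>\<open>real option\<close>. Times are monotone along a trace, so the
  first step satisfying \<open>P\<close> gives the earliest time.
\<close>

definition first_time :: "'p trace \<Rightarrow> (nat \<Rightarrow> bool) \<Rightarrow> real option" where
  "first_time X P = (if \<exists>n. P n then Some (time X (LEAST n. P n)) else None)"

definition earliest :: "'p::finite set \<Rightarrow> ('p \<Rightarrow> real option) \<Rightarrow> real option" where
  "earliest C F = (if \<exists>i\<in>C. F i \<noteq> None then Some (Min {t. \<exists>i\<in>C. F i = Some t}) else None)"

definition latest :: "'p::finite set \<Rightarrow> ('p \<Rightarrow> real option) \<Rightarrow> real option" where
  "latest C F = (if \<exists>i\<in>C. F i \<noteq> None then Some (Max {t. \<exists>i\<in>C. F i = Some t}) else None)"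

definition enters :: "nat \<Rightarrow> 'p::finite trace \<Rightarrow> 'p \<Rightarrow> nat \<Rightarrow> nat \<Rightarrow> bool" where
  "enters f X i v n \<longleftrightarrow> new_view f X i n = Some v"

definition attempts :: "nat \<Rightarrow> 'p::finite trace \<Rightarrow> 'p \<Rightarrow> nat \<Rightarrow> nat \<Rightarrow> bool" where
  "attempts f X i v n \<longleftrightarrow> event X n = Advance i \<and> last_entered f X i n = v"

definition E_proc :: "nat \<Rightarrow> 'p::finite trace \<Rightarrow> 'p \<Rightarrow> nat \<Rightarrow> real option" where
  "E_proc f X i v = first_time X (enters f X i v)"

definition A_proc :: "nat \<Rightarrow> 'p::finite trace \<Rightarrow> 'p \<Rightarrow> nat \<Rightarrow> real option" where
  "A_proc f X i v = first_time X (attempts f X i v)"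

definition E_first :: "nat \<Rightarrow> 'p::finite set \<Rightarrow> 'p trace \<Rightarrow> nat \<Rightarrow> real option" where
  "E_first f C X v = earliest C (\<lambda>i. E_proc f X i v)"

definition E_last :: "nat \<Rightarrow> 'p::finite set \<Rightarrow> 'p trace \<Rightarrow> nat \<Rightarrow> real option" where
  "E_last f C X v = latest C (\<lambda>i. E_proc f X i v)"

definition A_first :: "nat \<Rightarrow> 'p::finite set \<Rightarrow> 'p trace \<Rightarrow> nat \<Rightarrow> real option" where
  "A_first f C X v = earliest C (\<lambda>i. A_proc f X i v)"

text \<open>
  The view \<open>v\<close> is meant to be \<open>0\<close> or entered by some correct process, but \<open>i\<close> itself may have
  skipped \<open>v\<close> and leave it behind by entering a higher view directly.
\<close>

definition T_proc :: "nat \<Rightarrow> 'p::finite trace \<Rightarrow> 'p \<Rightarrow> nat \<Rightarrow> real option" where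
  "T_proc f X i v = first_time X (\<lambda>n. attempts f X i v n \<or> (\<exists>u>v. enters f X i u n))"

text \<open>
  Unlike \<open>E_last\<close>, this is undefined (rather than a maximum over the remaining processes) as soon as
  some correct process forever stays in views up to \<open>v\<close> without attempting to advance from \<open>v\<close>:
  a bound in terms of \<open>T_last\<close> presupposes that every correct process does leave \<open>v\<close>.
\<close>

definition T_last :: "nat \<Rightarrow> 'p::finite set \<Rightarrow> 'p trace \<Rightarrow> nat \<Rightarrow> real option" where
  "T_last f C X v =
     (if \<forall>i\<in>C. T_proc f X i v \<noteq> None then latest C (\<lambda>i. T_proc f X i v) else None)"

definition early_start :: "nat \<Rightarrow> 'p::finite set \<Rightarrow> real \<Rightarrow> 'p trace \<Rightarrow> bool" where
  "early_start f C GST X \<longleftrightarrow> (\<exists>a. A_first f C X 0 = Some a \<and> a < GST)"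

definition threshold_view :: "nat \<Rightarrow> 'p::finite set \<Rightarrow> real \<Rightarrow> real \<Rightarrow> 'p trace \<Rightarrow> nat" where
  "threshold_view f C GST \<rho> X =
     (if early_start f C GST X
      then Max {v. (\<exists>t. E_first f C X v = Some t \<and> t < GST + \<rho>) \<or> v = 0} + 1
      else 1)"

end

theory Submission
  imports Defs
begin

text \<open>
  Any view above \<open>v\<close> that a correct process wishes for can be traced back, through \<open>view_plus\<close>, to a
  correct process that called \<open>advance\<close> while in \<open>v\<close>: the earliest such wish cannot come from
  \<open>view_plus\<close>, so its sender has \<open>view = view_plus = v\<close>, which means that it entered \<open>v\<close>.
  For the timing bounds, once \<open>f + 1\<close> correct processes wish for a view \<open>\<ge> v\<close>, all correct processes
  repeat the wish one message delay later and have \<open>view \<ge> v\<close> after another delay; wishes lost before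
  \<open>GST\<close> are repeated by the periodic handler by \<open>GST + \<rho>\<close>, and there are none if no correct
  process attempts to advance before \<open>GST\<close>.
\<close>

section \<open>Quorum thresholds\<close>

text \<open>Turns both thresholds into counting, so that later arguments never handle the maximum.
  The bounds on \<open>k\<close> keep the set under \<open>Max\<close> nonempty and force a
  supported \<open>v\<close> to lie below some entry.\<close>

lemma le_largest_supported_iff:
  fixes m :: "'p::finite \<Rightarrow> nat"
  assumes "0 < k" "k \<le> card (UNIV :: 'p set)"
  shows "v \<le> largest_supported k m \<longleftrightarrow> k \<le> card {j. v \<le> m j}"
proof -
  let ?S = "{v \<in> range m. k \<le> card {j. v \<le> m j}}"
  have fin: "finite ?S" by simp
  have witness: "\<exists>u\<in>?S. v \<le> u" if k: "k \<le> card {j. v \<le> m j}" for v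
  proof -
    let ?A = "{j. v \<le> m j}"
    have ne: "?A \<noteq> {}" using k assms(1) by (metis card.empty not_less)
    \<comment> \<open>\<open>v\<close> need not be an entry of \<open>m\<close>; the least entry at
      or above it is one, and the same processes support it.\<close>
    let ?u = "Min (m ` ?A)"
    have u: "?u \<in> m ` ?A" using ne by (intro Min_in) auto
    have "?A \<subseteq> {j. ?u \<le> m j}" by auto
    hence "card ?A \<le> card {j. ?u \<le> m j}" by (intro card_mono) auto
    with u k show ?thesis by (intro bexI[of _ ?u]) auto
  qed
  have "?S \<noteq> {}" using witness[of 0] assms(2) by auto
  hence max: "Max ?S \<in> ?S" using fin by (rule Max_in[rotated])
  show ?thesis
  proof
    assume "v \<le> largest_supported k m"
    hence "card {j. Max ?S \<le> m j} \<le> card {j. v \<le> m j}"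
      unfolding largest_supported_def by (intro card_mono) auto
    thus "k \<le> card {j. v \<le> m j}" using max by simp
  next
    assume "k \<le> card {j. v \<le> m j}"
    then obtain u where "u \<in> ?S" "v \<le> u" using witness by blast
    thus "v \<le> largest_supported k m"
      unfolding largest_supported_def using Max_ge[OF fin] order_trans by blast
  qed
qed

section \<open>Earliest and latest times\<close>

lemma first_time_eq_None_iff: "first_time X P = None \<longleftrightarrow> (\<forall>n. \<not> P n)"
  by (simp add: first_time_def)

lemma first_time_SomeD:
  assumes "first_time X P = Some t"
  obtains n where "P n" "t = time X n"
  using assms by (metis LeastI_ex first_time_def option.distinct(1) option.inject)

lemma first_time_le:
  assumes "mono (time X)" "P n"
  obtains t where "first_time X P = Some t" "t \<le> time X n"
proof (rule that)
  show "first_time X P = Some (time X (LEAST n. P n))"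
    using assms(2) by (auto simp: first_time_def)
  show "time X (LEAST n. P n) \<le> time X n"
    using assms by (intro monoD[of "time X"] Least_le)
qed

lemma finite_times: "finite {t. \<exists>i\<in>C. F i = Some t}" for C :: "'p::finite set"
  by (rule finite_subset[of _ "(the \<circ> F) ` C"]) force+

lemma earliest_SomeD:
  assumes "earliest C F = Some t"
  obtains i where "i \<in> C" "F i = Some t"
proof -
  have "{t. \<exists>i\<in>C. F i = Some t} \<noteq> {}" "t = Min {t. \<exists>i\<in>C. F i = Some t}"
    using assms by (auto simp: earliest_def split: if_splits)
  with Min_in[OF finite_times] show ?thesis using that by blast
qed

lemma earliest_le:
  assumes "i \<in> C" "F i = Some u"
  obtains t where "earliest C F = Some t" "t \<le> u"
proof (rule that)
  show "earliest C F = Some (Min {t. \<exists>i\<in>C. F i = Some t})"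
    using assms by (auto simp: earliest_def)
  show "Min {t. \<exists>i\<in>C. F i = Some t} \<le> u"
    using assms by (intro Min_le finite_times) auto
qed

lemma latest_le:
  assumes "i \<in> C" "F i \<noteq> None" "\<And>j u. j \<in> C \<Longrightarrow> F j = Some u \<Longrightarrow> u \<le> b"
  obtains l where "latest C F = Some l" "l \<le> b"
proof (rule that)
  show "latest C F = Some (Max {t. \<exists>i\<in>C. F i = Some t})"
    using assms by (auto simp: latest_def)
  show "Max {t. \<exists>i\<in>C. F i = Some t} \<le> b"
    using assms finite_times[of C F] by (subst Max_le_iff) auto
qed

lemma latest_ge:
  assumes "latest C F = Some l" "i \<in> C" "F i = Some u"
  shows "u \<le> l"
  using assms by (auto simp: latest_def split: if_splits intro!: Max_ge finite_times)

section \<open>Local invariants\<close>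

declare state_at.simps(2) [simp del] last_entered.simps(2) [simp del]

text \<open>What the periodic handler sends if positive; no earlier wish of the process exceeds it.\<close>

definition level :: "'p local_state \<Rightarrow> nat" where
  "level s = (if advanced s then wish_view s else view_plus s)"

locale synchronizer =
  fixes f :: nat and C :: "'p::finite set" and GST \<delta> \<rho> :: real and X :: "'p trace"
  assumes exec: "synchronizer_execution f C GST \<delta> \<rho> X"
begin

abbreviation st :: "'p \<Rightarrow> nat \<Rightarrow> 'p local_state" where
  "st i n \<equiv> state_at f X i n"

lemma card_UNIV: "card (UNIV :: 'p set) = 3 * f + 1"
  and faulty: "card (- C) \<le> f"
  and params: "0 \<le> GST" "0 < \<delta>" "0 < \<rho>"
  and mono_time: "mono (time X)"
  and time_0: "0 \<le> time X 0"
  and time_unbounded: "filterlim (time X) at_top sequentially"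
  and recv_distinct: "i \<in> C \<Longrightarrow> n < m \<Longrightarrow> event X n = Recv i j v \<Longrightarrow>
    event X m = Recv i j' v' \<Longrightarrow> time X n < time X m"
  and origin: "i \<in> C \<Longrightarrow> j \<in> C \<Longrightarrow> event X n = Recv i j v \<Longrightarrow>
    sends f X j (origin X n) = Some v \<and> time X (origin X n) < time X n"
  and delivery: "i \<in> C \<Longrightarrow> j \<in> C \<Longrightarrow> sends f X j m = Some v \<Longrightarrow> GST \<le> time X m \<Longrightarrow>
    \<exists>n. event X n = Recv i j v \<and> time X n \<le> time X m + \<delta>"
  and clock_mono: "i \<in> C \<Longrightarrow> mono_on {0..} (clock X i)"
  and clock_real: "i \<in> C \<Longrightarrow> GST \<le> s \<Longrightarrow> s \<le> t \<Longrightarrow> clock X i t - clock X i s = t - s"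
  and periodic: "periodic C \<rho> X"
  using exec unfolding synchronizer_execution_def timing_def links_def local_clocks_def
  by blast+

lemma time_le: "n \<le> m \<Longrightarrow> time X n \<le> time X m"
  using mono_time by (rule monoD)

section \<open>Counting correct processes\<close>

lemma card_C: "2 * f + 1 \<le> card C"
proof -
  have "card C + card (- C) = card (UNIV :: 'p set)"
    using card_Un_disjoint[of C "- C"] by simp
  thus ?thesis using card_UNIV faulty by simp
qed

text \<open>At most \<open>f\<close> members of a set are faulty. Used with \<open>k = 1\<close> for
  supporters of \<open>view_plus\<close> and \<open>k = f + 1\<close> for those of
  \<open>view\<close>.\<close>

lemma card_Int_C:
  assumes "f + k \<le> card A"
  shows "k \<le> card (A \<inter> C)"
proof -
  have "card A \<le> card (A \<inter> C) + card (- C)"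
    by (rule order_trans[OF card_mono card_Un_le]) auto
  thus ?thesis using assms faulty by simp
qed

lemma supported_iff:
  "v \<le> largest_supported (2 * f + 1) (m :: 'p \<Rightarrow> nat) \<longleftrightarrow> 2 * f + 1 \<le> card {j. v \<le> m j}"
  "v \<le> largest_supported (f + 1) (m :: 'p \<Rightarrow> nat) \<longleftrightarrow> f + 1 \<le> card {j. v \<le> m j}"
  using card_UNIV by (intro le_largest_supported_iff; simp)+

lemma supported_zero:
  assumes "0 < k" "k \<le> card (UNIV :: 'p set)"
  shows "largest_supported k (\<lambda>_::'p. 0) = 0"
  using le_largest_supported_iff[of k 1 "\<lambda>_::'p. 0"] assms by simp

lemma step_cases [case_names Recv Timer Advance Other]:
  obtains (Recv) j v where "event X n = Recv i j v"
      "step f i (event X n) s = on_wish f j v s"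
    | (Timer) "event X n = Timer i" "step f i (event X n) s = on_timer s"
    | (Advance) "event X n = Advance i" "step f i (event X n) s = on_advance s"
    | (Other) "\<forall>j v. event X n \<noteq> Recv i j v" "event X n \<noteq> Timer i" "event X n \<noteq> Advance i"
      "step f i (event X n) s = (s, None, None)"
  by (cases "event X n") (auto simp: step_def split: if_splits)

text \<open>Only a receipt touches these variables, and it recomputes them from
  \<open>max_views\<close>; they therefore inherit the growth of \<open>max_views\<close>.\<close>

lemma views:
  "view (st i n) = largest_supported (2 * f + 1) (max_views (st i n)) \<and>
   view_plus (st i n) = largest_supported (f + 1) (max_views (st i n))"
proof (induction n)
  case 0
  show ?case using card_UNIV by (simp add: init_state_def supported_zero)
next
  case (Suc n)
  show ?case
    by (cases rule: step_cases[of n i "st i n"])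
      (use Suc in \<open>auto simp: state_at.simps(2) on_wish_def on_timer_def on_advance_def Let_def\<close>)
qed

lemma le_view_iff: "v \<le> view (st i n) \<longleftrightarrow> 2 * f + 1 \<le> card {j. v \<le> max_views (st i n) j}"
  and le_view_plus_iff: "v \<le> view_plus (st i n) \<longleftrightarrow> f + 1 \<le> card {j. v \<le> max_views (st i n) j}"
  using views supported_iff by presburger+

lemma view_le_view_plus: "view (st i n) \<le> view_plus (st i n)"
  using le_view_iff[of "view (st i n)" i n] by (subst le_view_plus_iff) simp

lemma max_views_Suc: "max_views (st i n) j \<le> max_views (st i (Suc n)) j"
  by (cases rule: step_cases[of n i "st i n"])
    (auto simp: state_at.simps(2) on_wish_def on_timer_def on_advance_def Let_def)

lemma max_views_mono: "n \<le> m \<Longrightarrow> max_views (st i n) j \<le> max_views (st i m) j"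
  by (rule lift_Suc_mono_le[of "\<lambda>n. max_views (st i n) j"]) (rule max_views_Suc)

lemma card_max_views_mono:
  assumes "n \<le> m"
  shows "card {j. v \<le> max_views (st i n) j} \<le> card {j. v \<le> max_views (st i m) j}"
  by (intro card_mono) (auto intro: order_trans max_views_mono[OF assms])

lemma view_mono: "n \<le> m \<Longrightarrow> view (st i n) \<le> view (st i m)"
  using le_view_iff card_max_views_mono by (meson order_refl order_trans)

lemma view_plus_mono: "n \<le> m \<Longrightarrow> view_plus (st i n) \<le> view_plus (st i m)"
  using le_view_plus_iff card_max_views_mono by (meson order_refl order_trans)

lemma max_views_recv:
  "event X n = Recv i j v \<Longrightarrow> v \<le> max_views (st i (Suc n)) j"
  by (auto simp: step_def state_at.simps(2) on_wish_def Let_def)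

lemma recv_of_max_views:
  assumes "0 < v" "v \<le> max_views (st i n) j"
  shows "\<exists>r<n. \<exists>w\<ge>v. event X r = Recv i j w"
  using assms(2)
proof (induction n)
  case 0
  thus ?case using assms(1) by (simp add: init_state_def)
next
  case (Suc n)
  show ?case
  proof (cases "v \<le> max_views (st i n) j")
    case True
    thus ?thesis using Suc.IH less_SucI by blast
  next
    case False
    with Suc.prems have "\<exists>w\<ge>v. event X n = Recv i j w"
      by (cases rule: step_cases[of n i "st i n"])
        (auto simp: state_at.simps(2) on_wish_def on_timer_def on_advance_def Let_def split: if_splits)
    thus ?thesis by blast
  qed
qed

section \<open>Entries into views and calls of \<open>advance\<close>\<close>

lemma enters_iff:
  "enters f X i v n \<longleftrightarrow> view (st i n) < view (st i (Suc n)) \<and> view (st i (Suc n)) = v \<and>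
    view_plus (st i (Suc n)) = v"
proof (cases rule: step_cases[of n i "st i n"])
  case (Recv j w)
  thus ?thesis by (auto simp: enters_def new_view_def state_at.simps(2) on_wish_def Let_def)
qed (auto simp: enters_def new_view_def state_at.simps(2) on_timer_def on_advance_def)

lemma enters_recv:
  assumes "enters f X i v n"
  shows "\<exists>j w. event X n = Recv i j w"
  using assms by (cases rule: step_cases[of n i "st i n"])
    (auto simp: enters_def new_view_def on_timer_def on_advance_def)

lemma last_entered_Suc:
  "last_entered f X i (Suc n) =
    (if view (st i n) < view (st i (Suc n)) \<and> view_plus (st i (Suc n)) = view (st i (Suc n))
     then view (st i (Suc n)) else last_entered f X i n)"
proof (cases "new_view f X i n")
  case None
  thus ?thesis using enters_iff[of i "view (st i (Suc n))" n]
    by (auto simp: enters_def last_entered.simps(2))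
next
  case (Some v)
  thus ?thesis using enters_iff[of i v n] by (auto simp: enters_def last_entered.simps(2))
qed

lemma last_entered_le: "last_entered f X i n \<le> view (st i n)"
proof (induction n)
  case (Suc n)
  thus ?case using view_mono[of n "Suc n" i] by (auto simp: last_entered_Suc)
qed simp

text \<open>If the variables agree after a step, either \<open>view\<close> grew and the step was an
  entry, or \<open>view\<close> stayed put; then \<open>view_plus\<close>, which never decreases or
  falls below \<open>view\<close>, agreed with it before.\<close>

lemma last_entered_eq:
  "view_plus (st i n) = view (st i n) \<Longrightarrow> last_entered f X i n = view (st i n)"
proof (induction n)
  case 0
  thus ?case by (simp add: init_state_def)
next
  case (Suc n)
  show ?case
    using Suc view_mono[of n "Suc n" i] view_plus_mono[of n "Suc n" i] view_le_view_plus[of i n]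
    by (auto simp: last_entered_Suc)
qed

lemma last_entered_entered:
  "0 < last_entered f X i n \<Longrightarrow> \<exists>m<n. enters f X i (last_entered f X i n) m"
proof (induction n)
  case (Suc n)
  thus ?case
    by (auto simp: last_entered.simps(2) enters_def split: option.splits intro: less_SucI)
qed simp

text \<open>Entering a view clears the flag, so a set flag stems from a call made since the last
  entry.\<close>

lemma advanced_attempts:
  "advanced (st i n) \<Longrightarrow> \<exists>m<n. attempts f X i (last_entered f X i n) m"
proof (induction n)
  case 0
  thus ?case by (simp add: init_state_def)
next
  case (Suc n)
  show ?case
  proof (cases rule: step_cases[of n i "st i n"])
    case (Recv j v)
    with Suc show ?thesis
      by (auto simp: state_at.simps(2) last_entered.simps(2) on_wish_def Let_def new_view_def
          split: if_splits intro: less_SucI)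
  next
    case Advance
    thus ?thesis
      by (auto simp: state_at.simps(2) last_entered.simps(2) on_advance_def new_view_def attempts_def)
  qed (use Suc in \<open>auto simp: state_at.simps(2) last_entered.simps(2) on_timer_def new_view_def
      intro: less_SucI\<close>)
qed

section \<open>Wishes\<close>

text \<open>The delicate case is a receipt that enters a view and clears the flag: the new
  \<open>view_plus\<close> equals the new \<open>view\<close>, hence is at least the old
  \<open>view + 1\<close>, and is no smaller than the old \<open>view_plus\<close>.\<close>

lemma level_Suc: "level (st i n) \<le> level (st i (Suc n))"
proof (cases rule: step_cases[of n i "st i n"])
  case (Recv j v)
  thus ?thesis
    using view_mono[of n "Suc n" i] view_plus_mono[of n "Suc n" i]
    by (auto simp: level_def wish_view_def state_at.simps(2) on_wish_def Let_def)
next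
  case Advance
  thus ?thesis by (auto simp: level_def wish_view_def state_at.simps(2) on_advance_def)
qed (auto simp: state_at.simps(2) on_timer_def)

lemma level_mono: "n \<le> m \<Longrightarrow> level (st i n) \<le> level (st i m)"
  by (rule lift_Suc_mono_le[of "\<lambda>n. level (st i n)"]) (rule level_Suc)

lemma sends_level:
  assumes "sends f X i n = Some w"
  shows "0 < w" "w \<le> level (st i (Suc n))"
proof (atomize (full), cases rule: step_cases[of n i "st i n"])
  case (Recv j v)
  with assms show "0 < w \<and> w \<le> level (st i (Suc n))"
    by (auto simp: sends_def level_def wish_view_def state_at.simps(2) on_wish_def Let_def split: if_splits)
next
  case Timer
  with assms show "0 < w \<and> w \<le> level (st i (Suc n))"
    by (auto simp: sends_def level_def wish_view_def state_at.simps(2) on_timer_def split: if_splits)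
next
  case Advance
  with assms show "0 < w \<and> w \<le> level (st i (Suc n))"
    by (auto simp: sends_def level_def wish_view_def state_at.simps(2) on_advance_def)
qed (use assms in \<open>auto simp: sends_def\<close>)

lemma timer_sends:
  assumes "event X n = Timer i" "0 < level (st i n)"
  shows "sends f X i n = Some (level (st i n))"
  using assms by (cases "advanced (st i n)") (auto simp: sends_def step_def on_timer_def level_def)

text \<open>Wishes for higher views count too, since a receiver only tests whether an entry is at
  least \<open>v\<close>.\<close>

definition wished :: "'p \<Rightarrow> nat \<Rightarrow> real \<Rightarrow> bool" where
  "wished j v s \<longleftrightarrow> (\<exists>m w. sends f X j m = Some w \<and> v \<le> w \<and> time X m \<le> s)"

lemma wished_mono: "wished j v s \<Longrightarrow> s \<le> s' \<Longrightarrow> wished j v s'"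
  unfolding wished_def by force

text \<open>A receipt that lifts \<open>view_plus\<close> to \<open>v\<close> or beyond broadcasts
  the new value in the same step; hence the state after step \<open>n\<close> goes with the time of
  step \<open>n\<close>.\<close>

lemma view_plus_wished:
  assumes "0 < v" "v \<le> view_plus (st i (Suc n))"
  shows "wished i v (time X n)"
  using assms(2)
proof (induction n)
  case (Suc n)
  show ?case
  proof (cases "v \<le> view_plus (st i (Suc n))")
    case True
    thus ?thesis using Suc.IH time_le[of n "Suc n"] wished_mono by simp
  next
    case False
    with Suc.prems have "sends f X i (Suc n) = Some (view_plus (st i (Suc (Suc n))))"
      by (cases rule: step_cases[of "Suc n" i "st i (Suc n)"])
        (auto simp: sends_def state_at.simps(2) on_wish_def on_timer_def on_advance_def Let_def)
    thus ?thesis using Suc.prems unfolding wished_def by blast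
  qed
next
  case 0
  have "sends f X i 0 = Some (view_plus (st i (Suc 0)))"
    using assms(1) 0 by (cases rule: step_cases[of 0 i "st i 0"])
      (auto simp: sends_def state_at.simps(2) on_wish_def on_timer_def on_advance_def Let_def init_state_def)
  thus ?case using 0 unfolding wished_def by blast
qed

lemma max_views_sender:
  assumes "i \<in> C" "j \<in> C" "0 < v" "v \<le> max_views (st i n) j"
  obtains r m w where "r < n" "m < r" "sends f X j m = Some w" "v \<le> w" "time X m < time X r"
proof -
  obtain r w where r: "r < n" "v \<le> w" "event X r = Recv i j w"
    using recv_of_max_views assms by blast
  with origin assms have "sends f X j (origin X r) = Some w" "time X (origin X r) < time X r"
    by blast+
  \<comment> \<open>Positive message delay makes the send an earlier step too, which gives the
    descent for induction over steps.\<close>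
  moreover have "origin X r < r" using calculation(2) time_le by (meson not_le)
  ultimately show ?thesis using that r by blast
qed

lemma view_plus_sender:
  assumes "i \<in> C" "v < view_plus (st i n)"
  obtains j r m w where "j \<in> C" "r < n" "m < r" "sends f X j m = Some w" "v < w"
    "time X m < time X r"
proof -
  have "1 \<le> card ({j. Suc v \<le> max_views (st i n) j} \<inter> C)"
    using assms(2) by (intro card_Int_C) (metis Suc_leI le_view_plus_iff)
  then obtain j where j: "j \<in> C" "Suc v \<le> max_views (st i n) j"
    by (metis (no_types, lifting) Int_iff card.empty ex_in_conv mem_Collect_eq not_one_le_zero)
  obtain r m w where "r < n" "m < r" "sends f X j m = Some w" "Suc v \<le> w" "time X m < time X r"
    using max_views_sender[OF assms(1) j(1) zero_less_Suc j(2)] .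
  thus ?thesis using that j(1) by auto
qed

text \<open>Strong induction on the sending step: a wish resting on \<open>view_plus > v\<close> was
  caused by an earlier wish above \<open>v\<close> of a correct process; any other shows that the
  sender itself called \<open>advance\<close> in \<open>v\<close>.\<close>

lemma wish_attempt:
  "i \<in> C \<Longrightarrow> sends f X i n = Some w \<Longrightarrow> v < w \<Longrightarrow> \<exists>k\<in>C. \<exists>m\<le>n. attempts f X k v m"
proof (induction n arbitrary: i w rule: less_induct)
  case (less n)
  \<comment> \<open>\<open>Suc n\<close> is allowed because a receipt broadcasts the
    \<open>view_plus\<close> computed in the step itself; the causing send still lies strictly
    before step \<open>n\<close>.\<close>
  have plus: ?case if n': "v < view_plus (st i n')" "n' \<le> Suc n" for n'
  proof -
    obtain j r m w' where "j \<in> C" "r < n'" "m < r" "sends f X j m = Some w'" "v < w'"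
        "time X m < time X r"
      using view_plus_sender[OF less.prems(1) n'(1)] .
    moreover from this have "m < n" using n'(2) by simp
    ultimately obtain k m' where "k \<in> C" "m' \<le> m" "attempts f X k v m'"
      using less.IH[of m j w'] by blast
    moreover from this have "m' \<le> n" using \<open>m < n\<close> by simp
    ultimately show ?thesis by blast
  qed
  \<comment> \<open>From \<open>view \<le> view_plus \<le> v\<close> and
    \<open>wish_view > v\<close> only \<open>view + 1 > v\<close> remains, so both variables equal
    \<open>v\<close>.\<close>
  have last: "last_entered f X i n = v"
    if "\<not> v < view_plus (st i n)" "v < wish_view (st i n)"
  proof -
    have "view_plus (st i n) = v" "view (st i n) = v"
      using that view_le_view_plus[of i n] by (auto simp: wish_view_def less_max_iff_disj)
    thus ?thesis using last_entered_eq[of i n] by simp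
  qed
  show ?case
  proof (cases rule: step_cases[of n i "st i n"])
    case (Recv j u)
    with less.prems have "v < view_plus (st i (Suc n))"
      by (auto simp: sends_def state_at.simps(2) on_wish_def Let_def split: if_splits)
    thus ?thesis using plus[of "Suc n"] by simp
  next
    case Timer
    show ?thesis
    proof (cases "v < view_plus (st i n)")
      case False
      with Timer less.prems have "advanced (st i n)" "v < wish_view (st i n)"
        by (auto simp: sends_def state_at.simps(2) on_timer_def split: if_splits)
      with last[OF False] obtain m where "m < n" "attempts f X i v m"
        using advanced_attempts[of i n] by auto
      with less.prems(1) show ?thesis by (meson less_imp_le)
    qed (simp add: plus[of n])
  next
    case Advance
    show ?thesis
    proof (cases "v < view_plus (st i n)")
      case False
      with Advance less.prems have "v < wish_view (st i n)"
        by (auto simp: sends_def state_at.simps(2) on_advance_def)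
      with last[OF False] Advance(1) have "attempts f X i v n" by (simp add: attempts_def)
      with less.prems(1) show ?thesis by blast
    qed (simp add: plus[of n])
  next
    case Other
    with less.prems show ?thesis by (simp add: sends_def)
  qed
qed

lemma attempt_wished:
  assumes "attempts f X i v n"
  shows "wished i (v + 1) (time X n)"
proof -
  have "sends f X i n = Some (wish_view (st i n))"
    using assms by (simp add: attempts_def sends_def step_def on_advance_def)
  moreover have "v + 1 \<le> wish_view (st i n)"
    using assms last_entered_le[of i n] by (auto simp: attempts_def wish_view_def)
  ultimately show ?thesis unfolding wished_def by blast
qed

lemma enters_wished:
  assumes "enters f X i u n" "v \<le> u" "0 < v"
  shows "wished i v (time X n)"
  using assms view_plus_wished[of v i n] by (simp add: enters_iff)

text \<open>Process \<open>i\<close> may skip \<open>u\<close>, but not all correct ones do: if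
  \<open>view_plus\<close> is above \<open>u\<close>, a correct process advanced from
  \<open>u\<close> and so had entered it; otherwise both variables of \<open>i\<close> equal
  \<open>u\<close> and \<open>i\<close> entered it.\<close>

lemma view_reached_entered:
  assumes "i \<in> C" "0 < u" "u \<le> view (st i n)"
  shows "\<exists>j\<in>C. \<exists>m. enters f X j u m"
proof (cases "u < view_plus (st i n)")
  case True
  obtain j r m w where "j \<in> C" "r < n" "m < r" "sends f X j m = Some w" "u < w"
      "time X m < time X r"
    using view_plus_sender[OF assms(1) True] .
  then obtain k m' where "k \<in> C" "attempts f X k u m'"
    using wish_attempt by blast
  thus ?thesis using last_entered_entered[of k m'] assms(2) by (auto simp: attempts_def)
next
  case False
  hence "last_entered f X i n = u"
    using last_entered_eq[of i n] view_le_view_plus[of i n] assms(3) by simp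
  thus ?thesis using last_entered_entered[of i n] assms(1,2) by auto
qed

section \<open>Propagation of wishes\<close>

text \<open>From time \<open>s\<close> on, no wish is outdated: it has been repeated since \<open>GST\<close>, hence is delivered.\<close>

definition settled :: "real \<Rightarrow> bool" where
  "settled s \<longleftrightarrow> (\<forall>t\<ge>s. \<forall>j\<in>C. \<forall>v>0. wished j v t \<longrightarrow>
     (\<exists>m w. sends f X j m = Some w \<and> v \<le> w \<and> GST \<le> time X m \<and> time X m \<le> t))"

lemma settled_mono: "settled s \<Longrightarrow> s \<le> s' \<Longrightarrow> settled s'"
  unfolding settled_def by auto

text \<open>The first tick from \<open>GST\<close> on works: its predecessor fell before
  \<open>GST\<close>, so it is at most one period of the local clock past \<open>GST\<close>, where
  local and real durations agree. For tick 0 the bound on the phase replaces the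
  predecessor.\<close>

lemma tick_after_GST:
  assumes "i \<in> C"
  obtains n where "event X n = Timer i" "GST \<le> time X n" "time X n \<le> GST + \<rho>"
proof -
  obtain c and tick :: "nat \<Rightarrow> nat" where c: "c \<le> clock X i 0 + \<rho>"
    and tick: "strict_mono tick" "range tick = {n. event X n = Timer i}"
    and clk: "\<And>k. clock X i (time X (tick k)) = c + real k * \<rho>"
    using periodic assms unfolding periodic_def by blast
  have nonneg: "0 \<le> time X n" for n using time_0 time_le[of 0 n] by simp
  have "filterlim (\<lambda>k. time X (tick k)) at_top sequentially"
    using filterlim_compose[OF time_unbounded filterlim_subseq[OF tick(1)]] .
  hence ex: "\<exists>k. GST \<le> time X (tick k)"
    by (auto simp: filterlim_at_top eventually_sequentially)
  define k where "k = (LEAST k. GST \<le> time X (tick k))"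
  have k: "GST \<le> time X (tick k)" unfolding k_def using ex by (rule LeastI_ex)
  have "c + real k * \<rho> \<le> clock X i GST + \<rho>"
  proof (cases k)
    case 0
    have "clock X i 0 \<le> clock X i GST"
      using clock_mono[OF assms] params(1) by (auto intro: mono_onD)
    thus ?thesis using c 0 by simp
  next
    case (Suc k')
    hence "time X (tick k') < GST"
      using not_less_Least[of k' "\<lambda>k. GST \<le> time X (tick k)"] unfolding k_def by auto
    hence "clock X i (time X (tick k')) \<le> clock X i GST"
      using clock_mono[OF assms] params(1) nonneg by (auto intro: mono_onD)
    thus ?thesis using clk[of k'] Suc by (simp add: algebra_simps)
  qed
  hence "time X (tick k) \<le> GST + \<rho>"
    using clock_real[OF assms order_refl k] clk[of k] by simp
  thus ?thesis using that[of "tick k"] k tick(2) by auto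
qed

text \<open>A wish sent before \<open>GST\<close> may be lost, but the sender's tick between
  \<open>GST\<close> and \<open>GST + \<rho>\<close> sends its current \<open>level\<close>, which
  is at least that wish.\<close>

lemma settled_after_GST: "settled (GST + \<rho>)"
  unfolding settled_def
proof (intro allI impI ballI)
  fix t j v
  assume t: "GST + \<rho> \<le> t" and j: "j \<in> C" and v: "(0::nat) < v" and "wished j v t"
  then obtain m w where m: "sends f X j m = Some w" "v \<le> w" "time X m \<le> t"
    unfolding wished_def by blast
  show "\<exists>m w. sends f X j m = Some w \<and> v \<le> w \<and> GST \<le> time X m \<and> time X m \<le> t"
  proof (cases "GST \<le> time X m")
    case False
    obtain n where n: "event X n = Timer j" "GST \<le> time X n" "time X n \<le> GST + \<rho>"
      using tick_after_GST[OF j] .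
    have "m < n" using False n(2) time_le[of n m] by (meson not_le order_trans)
    hence "w \<le> level (st j n)"
      using sends_level(2)[OF m(1)] level_mono[of "Suc m" n j] by simp
    with timer_sends[OF n(1)] v m(2) n t show ?thesis by force
  qed (use m in blast)
qed

lemma A_first_le:
  assumes "k \<in> C" "attempts f X k v m"
  obtains a where "A_first f C X v = Some a" "a \<le> time X m"
proof -
  obtain t where "A_proc f X k v = Some t" "t \<le> time X m"
    unfolding A_proc_def using first_time_le[where P = "attempts f X k v", OF mono_time assms(2)] .
  with earliest_le[where F = "\<lambda>i. A_proc f X i v", OF assms(1)] that show ?thesis
    unfolding A_first_def by (metis order_trans)
qed

text \<open>Every wish is positive and thus preceded by an attempt to advance from view 0; with no
  such attempt before \<open>GST\<close>, every wish is sent from \<open>GST\<close> on.\<close>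

lemma settled_late_start:
  assumes "\<not> early_start f C GST X"
  shows "settled s"
  unfolding settled_def
proof (intro allI impI ballI)
  fix t j v
  assume j: "j \<in> C" and "wished j v t"
  then obtain m w where m: "sends f X j m = Some w" "v \<le> w" "time X m \<le> t"
    unfolding wished_def by blast
  obtain k m' where k: "k \<in> C" "m' \<le> m" "attempts f X k 0 m'"
    using wish_attempt[OF j m(1) sends_level(1)[OF m(1)]] by blast
  obtain a where "A_first f C X 0 = Some a" "a \<le> time X m'"
    using A_first_le[OF k(1,3)] .
  hence "GST \<le> time X m"
    using assms time_le[OF k(2)] unfolding early_start_def by fastforce
  thus "\<exists>m w. sends f X j m = Some w \<and> v \<le> w \<and> GST \<le> time X m \<and> time X m \<le> t"
    using m by blast
qed

section \<open>Delivery and amplification of settled wishes\<close>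

lemma wishes_received:
  assumes "settled s" "i \<in> C" "Q \<subseteq> C" "Q \<noteq> {}" "0 < v" "\<forall>j\<in>Q. wished j v s"
  obtains n where "time X n \<le> s + \<delta>" "card Q \<le> card {j. v \<le> max_views (st i (Suc n)) j}"
proof -
  have "\<forall>j\<in>Q. \<exists>n. time X n \<le> s + \<delta> \<and> v \<le> max_views (st i (Suc n)) j"
  proof
    fix j assume j: "j \<in> Q"
    then obtain m w where m: "sends f X j m = Some w" "v \<le> w" "GST \<le> time X m" "time X m \<le> s"
      using assms unfolding settled_def by blast
    then obtain n where n: "event X n = Recv i j w" "time X n \<le> time X m + \<delta>"
      using delivery assms(2,3) j by blast
    have "v \<le> max_views (st i (Suc n)) j"
      using max_views_recv[OF n(1)] m(2) by simp
    thus "\<exists>n. time X n \<le> s + \<delta> \<and> v \<le> max_views (st i (Suc n)) j"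
      using n(2) m(4) by (intro exI[of _ n]) simp
  qed
  then obtain N where N: "\<forall>j\<in>Q. time X (N j) \<le> s + \<delta> \<and> v \<le> max_views (st i (Suc (N j))) j"
    by (rule bchoice[elim_format]) blast
  \<comment> \<open>The last of the chosen receipts: entries never decrease, so all of
    \<open>Q\<close> is counted after it.\<close>
  let ?n = "Max (N ` Q)"
  have max: "?n \<in> N ` Q" using assms(4) by (intro Max_in) auto
  have "Q \<subseteq> {j. v \<le> max_views (st i (Suc ?n)) j}"
  proof
    fix j assume j: "j \<in> Q"
    hence "Suc (N j) \<le> Suc ?n" by simp
    from max_views_mono[OF this] N j show "j \<in> {j. v \<le> max_views (st i (Suc ?n)) j}"
      by (auto intro: order_trans)
  qed
  hence "card Q \<le> card {j. v \<le> max_views (st i (Suc ?n)) j}" by (intro card_mono) auto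
  moreover have "time X ?n \<le> s + \<delta>" using max N by auto
  ultimately show ?thesis using that by blast
qed

lemma all_wish_reach:
  assumes "settled s" "0 < v" "\<forall>j\<in>C. wished j v s" "i \<in> C"
  obtains n where "time X n \<le> s + \<delta>" "v \<le> view (st i (Suc n))"
proof -
  obtain n where "time X n \<le> s + \<delta>" "card C \<le> card {j. v \<le> max_views (st i (Suc n)) j}"
    using wishes_received[of s i C v] assms by blast
  thus ?thesis using that card_C le_view_iff[of v i "Suc n"] by (meson order_trans)
qed

text \<open>One delay brings the \<open>f + 1\<close> wishes to every correct process, which then
  has wished for \<open>v\<close> as well; a second delay brings the wishes of all correct processes
  to \<open>i\<close>.\<close>

lemma amplification:
  assumes "settled s" "0 < v" "Q \<subseteq> C" "f + 1 \<le> card Q" "\<forall>j\<in>Q. wished j v s" "i \<in> C"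
  obtains n where "time X n \<le> s + 2 * \<delta>" "v \<le> view (st i (Suc n))"
proof -
  have "wished j v (s + \<delta>)" if j: "j \<in> C" for j
  proof -
    have "Q \<noteq> {}" using assms(4) by auto
    then obtain n where n: "time X n \<le> s + \<delta>"
        "card Q \<le> card {k. v \<le> max_views (st j (Suc n)) k}"
      using wishes_received[OF assms(1) j assms(3) _ assms(2,5)] by blast
    hence "v \<le> view_plus (st j (Suc n))"
      using assms(4) le_view_plus_iff[of v j "Suc n"] by simp
    thus ?thesis using wished_mono[OF view_plus_wished[OF assms(2)] n(1)] by blast
  qed
  hence "\<forall>j\<in>C. wished j v (s + \<delta>)" ..
  moreover have "settled (s + \<delta>)" using settled_mono[OF assms(1)] params by simp
  ultimately obtain n where "time X n \<le> s + \<delta> + \<delta>" "v \<le> view (st i (Suc n))"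
    using all_wish_reach[OF _ assms(2) _ assms(6)] by blast
  thus ?thesis using that[of n] by simp
qed

text \<open>Of the \<open>2 * f + 1\<close> supporters behind an entry at least \<open>f + 1\<close>
  are correct and sent their wishes earlier, which is enough for amplification.\<close>

lemma entered_reach:
  assumes "settled s" "k \<in> C" "enters f X k v n0" "time X n0 \<le> s" "i \<in> C"
  obtains n where "time X n \<le> s + 2 * \<delta>" "v \<le> view (st i (Suc n))"
proof -
  let ?Q = "{j. v \<le> max_views (st k (Suc n0)) j} \<inter> C"
  have v: "0 < v" "v \<le> view (st k (Suc n0))" using assms(3) by (auto simp: enters_iff)
  hence "f + 1 \<le> card ?Q"
    using le_view_iff[of v k "Suc n0"] by (intro card_Int_C) simp
  moreover have "\<forall>j\<in>?Q. wished j v s"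
  proof
    fix j assume "j \<in> ?Q"
    hence j: "j \<in> C" "v \<le> max_views (st k (Suc n0)) j" by auto
    obtain r m w where m: "r < Suc n0" "m < r" "sends f X j m = Some w" "v \<le> w"
        "time X m < time X r"
      using max_views_sender[OF assms(2) j(1) v(1) j(2)] .
    hence "time X m \<le> s" using time_le[of m n0] assms(4) by simp
    with m show "wished j v s" unfolding wished_def by blast
  qed
  ultimately show ?thesis
    using amplification[OF assms(1) v(1) _ _ _ assms(5), of ?Q] that by blast
qed

lemma eventually_settled: obtains s where "settled s" "t \<le> s"
  using that[of "max t (GST + \<rho>)"] settled_mono[OF settled_after_GST] by simp

text \<open>Entering \<open>v\<close> lifts \<open>view\<close> from below \<open>v\<close>, which
  cannot happen once \<open>view\<close> has reached \<open>v\<close>; bounds on reaching a view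
  thus bound its entry.\<close>

lemma enters_before_reached:
  assumes "enters f X i v m" "v \<le> view (st i (Suc n))"
  shows "time X m \<le> time X n"
proof -
  have "view (st i m) < view (st i (Suc n))" using assms by (simp add: enters_iff)
  hence "\<not> Suc n \<le> m" using view_mono[of "Suc n" m i] by (meson not_le)
  thus ?thesis using time_le by simp
qed

section \<open>The synchronizer properties\<close>

lemma E_proc_SomeD:
  assumes "E_proc f X i v = Some t"
  obtains n where "enters f X i v n" "t = time X n"
  using assms unfolding E_proc_def by (rule first_time_SomeD)

lemma E_proc_None_iff: "E_proc f X i v = None \<longleftrightarrow> (\<forall>n. \<not> enters f X i v n)"
  by (simp add: E_proc_def first_time_eq_None_iff)

lemma E_first_SomeD:
  assumes "E_first f C X v = Some t"
  obtains i n where "i \<in> C" "enters f X i v n" "t = time X n"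
  using assms unfolding E_first_def by (metis E_proc_SomeD earliest_SomeD)

lemma E_first_None_iff: "E_first f C X v = None \<longleftrightarrow> (\<forall>i\<in>C. \<forall>n. \<not> enters f X i v n)"
  by (auto simp: E_first_def earliest_def E_proc_None_iff)

text \<open>Bounding the moment when \<open>view\<close> reaches \<open>v\<close> suffices:
  processes that skip \<open>v\<close> do not count in the maximum.\<close>

lemma E_last_le:
  assumes "E_first f C X v \<noteq> None" "\<And>i. i \<in> C \<Longrightarrow> \<exists>n. time X n \<le> b \<and> v \<le> view (st i (Suc n))"
  shows "\<exists>l. E_last f C X v = Some l \<and> l \<le> b"
proof -
  obtain i where i: "i \<in> C" "E_proc f X i v \<noteq> None"
    using assms(1) by (auto simp: E_first_None_iff E_proc_None_iff)
  have "u \<le> b" if "j \<in> C" "E_proc f X j v = Some u" for j u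
    using E_proc_SomeD[OF that(2)] assms(2)[OF that(1)] enters_before_reached
    by (metis order_trans)
  with latest_le[where F = "\<lambda>i. E_proc f X i v", OF i] show ?thesis
    unfolding E_last_def by blast
qed

text \<open>Since \<open>view\<close> only grows, entries of different views are ordered steps; both
  are receipts, whose times at one process are distinct, so the order is strict in time.\<close>

lemma monotonicity:
  assumes "i \<in> C" "E_proc f X i v = Some t" "E_proc f X i v' = Some t'"
  shows "v < v' \<longleftrightarrow> t < t'"
proof -
  have less: "time X n < time X n'"
    if "enters f X i u n" "enters f X i u' n'" "u < u'" for u u' n n'
  proof -
    have "\<not> n' < n"
      using that view_mono[of "Suc n'" n i] by (auto simp: enters_iff Suc_le_eq)
    moreover have "n \<noteq> n'" using that by (auto simp: enters_iff)
    ultimately have "n < n'" by simp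
    thus ?thesis using recv_distinct[OF assms(1)] enters_recv that(1,2) by metis
  qed
  show ?thesis
    using E_proc_SomeD[OF assms(2)] E_proc_SomeD[OF assms(3)] less assms(2,3)
    by (metis less_asym linorder_neqE_nat option.inject order_less_irrefl)
qed

text \<open>The attempt precedes or coincides with the send of a wish above \<open>v\<close>; the
  positive delay of that message makes the bound strict.\<close>

lemma view_plus_attempt:
  assumes "i \<in> C" "v < view_plus (st i (Suc n))"
  shows "\<exists>a. A_first f C X v = Some a \<and> a < time X n"
proof -
  obtain j r m w where j: "j \<in> C" "r < Suc n" "m < r" "sends f X j m = Some w" "v < w"
      "time X m < time X r"
    using view_plus_sender[OF assms] .
  obtain k m' where k: "k \<in> C" "m' \<le> m" "attempts f X k v m'"
    using wish_attempt[OF j(1,4,5)] by blast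
  obtain a where "A_first f C X v = Some a" "a \<le> time X m'"
    using A_first_le[OF k(1,3)] .
  moreover have "time X m' \<le> time X m" "time X r \<le> time X n"
    using time_le k(2) j(2) by auto
  ultimately show ?thesis using j(6) by auto
qed

lemma validity:
  assumes "i \<in> C" "E_proc f X i (v + 1) = Some t"
  shows "\<exists>a. A_first f C X v = Some a \<and> a < t"
proof -
  obtain n where n: "enters f X i (v + 1) n" "t = time X n" using E_proc_SomeD[OF assms(2)] .
  hence "v < view_plus (st i (Suc n))" by (simp add: enters_iff)
  thus ?thesis using view_plus_attempt[OF assms(1)] n(2) by simp
qed

text \<open>After an early start, \<open>v\<close> exceeds every view first entered before
  \<open>GST + \<rho>\<close>, so \<open>t\<close> is no earlier than that; otherwise every time is
  settled.\<close>

lemma threshold_settled: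
  assumes "threshold_view f C GST \<rho> X \<le> v" "E_first f C X v = Some t"
  shows "settled t"
proof (cases "early_start f C GST X")
  case True
  let ?S = "{v. (\<exists>t. E_first f C X v = Some t \<and> t < GST + \<rho>) \<or> v = 0}"
  obtain N where N: "\<forall>n\<ge>N. GST + \<rho> \<le> time X n"
    using time_unbounded by (auto simp: filterlim_at_top eventually_sequentially)
  \<comment> \<open>\<open>Max\<close> is meaningful only for a finite set: finitely many steps lie
    before \<open>GST + \<rho>\<close>, and an entered view is the value of \<open>view\<close>
    right after such a step.\<close>
  have "?S \<subseteq> insert 0 ((\<lambda>(i, n). view (st i n)) ` (C \<times> {..N}))"
  proof
    fix u assume u: "u \<in> ?S"
    show "u \<in> insert 0 ((\<lambda>(i, n). view (st i n)) ` (C \<times> {..N}))"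
    proof (cases "u = 0")
      case False
      with u obtain t where "E_first f C X u = Some t" "t < GST + \<rho>" by auto
      then obtain i n where "i \<in> C" "enters f X i u n" "time X n < GST + \<rho>"
        using E_first_SomeD by metis
      moreover from this have "Suc n \<le> N" using N by (meson not_less not_less_eq_eq)
      ultimately show ?thesis
        by (intro insertI2 image_eqI[of _ _ "(i, Suc n)"]) (auto simp: enters_iff)
    qed simp
  qed
  hence fin: "finite ?S" by (rule finite_subset) simp
  have "Max ?S + 1 \<le> v" using assms(1) True by (simp add: threshold_view_def)
  hence "\<not> v \<le> Max ?S" by linarith
  hence "v \<notin> ?S" using Max_ge[OF fin] by blast
  hence "GST + \<rho> \<le> t" using assms(2) by auto
  thus ?thesis using settled_mono[OF settled_after_GST] by blast
qed (rule settled_late_start)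

lemma bounded_entry:
  assumes "threshold_view f C GST \<rho> X \<le> v" "E_first f C X v = Some t"
    and late: "\<not> (\<exists>a. A_first f C X v = Some a \<and> a < t + 2 * \<delta>)"
  shows "(\<forall>i\<in>C. E_proc f X i v \<noteq> None) \<and> (\<exists>l. E_last f C X v = Some l \<and> l \<le> t + 2 * \<delta>)"
proof -
  obtain k n0 where k: "k \<in> C" "enters f X k v n0" "t = time X n0"
    using E_first_SomeD[OF assms(2)] .
  have v: "0 < v" using k(2) by (auto simp: enters_iff)
  have reach: "\<exists>n. time X n \<le> t + 2 * \<delta> \<and> v \<le> view (st i (Suc n))" if "i \<in> C" for i
    using entered_reach[OF threshold_settled[OF assms(1,2)] k(1,2)] k(3) that
    by (metis order_refl)
  have "E_proc f X i v \<noteq> None" if i: "i \<in> C" for i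
  proof -
    obtain n where n: "time X n \<le> t + 2 * \<delta>" "v \<le> view (st i (Suc n))" using reach i by blast
    \<comment> \<open>A larger \<open>view_plus\<close> would need an attempt to advance from
      \<open>v\<close> before \<open>t + 2 * \<delta>\<close>. Hence both variables equal
      \<open>v\<close>, which marks an entry.\<close>
    have "\<not> v < view_plus (st i (Suc n))"
      using view_plus_attempt[OF i] late n(1) by (meson order_less_le_trans)
    hence "last_entered f X i (Suc n) = v"
      using n(2) view_le_view_plus[of i "Suc n"] last_entered_eq[of i "Suc n"]
      by simp
    thus ?thesis
      using last_entered_entered[of i "Suc n"] v E_proc_None_iff by metis
  qed
  moreover have "\<exists>l. E_last f C X v = Some l \<and> l \<le> t + 2 * \<delta>"
    using assms(2) reach by (intro E_last_le) auto
  ultimately show ?thesis by blast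
qed

section \<open>Leaving views: startup, progress and last entries\<close>

lemma left_wished:
  assumes "T_proc f X i v = Some t"
  shows "wished i (v + 1) t"
proof -
  obtain n where "attempts f X i v n \<or> (\<exists>u>v. enters f X i u n)" "t = time X n"
    using assms unfolding T_proc_def by (rule first_time_SomeD)
  thus ?thesis using attempt_wished enters_wished[of i _ n "v + 1"] by auto
qed

lemma common_wish_time:
  assumes "\<And>i. i \<in> Q \<Longrightarrow> \<exists>t. wished i v t"
  obtains s where "settled s" "\<forall>i\<in>Q. wished i v s"
proof -
  obtain T where T: "\<forall>i\<in>Q. wished i v (T i)" using assms by metis
  \<comment> \<open>The inserted 0 covers an empty \<open>Q\<close>.\<close>
  obtain s where s: "settled s" "Max (insert 0 (T ` Q)) \<le> s" by (rule eventually_settled)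
  have "T i \<le> s" if "i \<in> Q" for i using that s(2) by simp
  thus ?thesis using that s(1) T wished_mono by blast
qed

text \<open>Every correct process leaves view 0 and so wishes for view 1; these wishes lift some
  \<open>view\<close> to at least 1, and a reached view is entered by a correct process.\<close>

lemma startup:
  assumes "\<forall>i\<in>C. T_proc f X i 0 \<noteq> None"
  shows "E_first f C X 1 \<noteq> None"
proof -
  have "\<exists>t. wished i 1 t" if "i \<in> C" for i
    using assms that left_wished[of i 0] by auto
  then obtain s where s: "settled s" "\<forall>i\<in>C. wished i 1 s"
    using common_wish_time[of C 1] by blast
  have "C \<noteq> {}" using card_C by auto
  then obtain i where i: "i \<in> C" by blast
  obtain n where "time X n \<le> s + \<delta>" "1 \<le> view (st i (Suc n))"
    using all_wish_reach[OF s(1) zero_less_one s(2) i] .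
  thus ?thesis using view_reached_entered[OF i zero_less_one] E_first_None_iff by metis
qed

lemma progress:
  assumes "E_first f C X v \<noteq> None" "P \<subseteq> C" "card P = f + 1"
    and P: "\<forall>i\<in>P. E_proc f X i v \<noteq> None \<longrightarrow> A_proc f X i v \<noteq> None"
  shows "E_first f C X (v + 1) \<noteq> None"
proof -
  obtain k n0 where k: "k \<in> C" "enters f X k v n0"
    using assms(1) by (auto simp: E_first_None_iff)
  have v: "0 < v" using k(2) by (auto simp: enters_iff)
  obtain s0 where s0: "settled s0" "time X n0 \<le> s0" by (rule eventually_settled)
  have "\<exists>t. wished i (v + 1) t" if i: "i \<in> P" for i
  proof (cases "E_proc f X i v = None")
    case True
    have "i \<in> C" using i assms(2) by blast
    then obtain n where n: "v \<le> view (st i (Suc n))"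
      using entered_reach[OF s0(1) k s0(2)] by metis
    \<comment> \<open>A process that never enters \<open>v\<close> still reaches it, so
      \<open>view_plus\<close> must be above \<open>v\<close>: were both variables equal to
      \<open>v\<close>, it would have entered \<open>v\<close>. It has therefore wished for
      \<open>v + 1\<close>.\<close>
    have "last_entered f X i (Suc n) \<noteq> v"
      using True v last_entered_entered[of i "Suc n"] E_proc_None_iff by metis
    hence "v + 1 \<le> view_plus (st i (Suc n))"
      using n last_entered_eq[of i "Suc n"] view_le_view_plus[of i "Suc n"]
      by (cases "view_plus (st i (Suc n)) = view (st i (Suc n))") simp_all
    thus ?thesis using view_plus_wished[of "v + 1" i n] by auto
  next
    case False
    then obtain n where "attempts f X i v n"
      using P i by (auto simp: A_proc_def first_time_eq_None_iff)
    thus ?thesis using attempt_wished by blast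
  qed
  then obtain s where s: "settled s" "\<forall>i\<in>P. wished i (v + 1) s"
    using common_wish_time[of P "v + 1"] by blast
  have pos: "0 < v + 1" "f + 1 \<le> card P" using assms(3) by simp_all
  obtain n where "time X n \<le> s + 2 * \<delta>" "v + 1 \<le> view (st k (Suc n))"
    using amplification[OF s(1) pos(1) assms(2) pos(2) s(2) k(1)] .
  thus ?thesis using view_reached_entered[OF k(1) pos(1)] E_first_None_iff by metis
qed

lemma entry_after_first:
  assumes "E_first f C X v = Some t"
  shows "\<exists>l. E_last f C X v = Some l \<and> l \<le> max t (GST + \<rho>) + 2 * \<delta>"
proof (rule E_last_le)
  obtain k n0 where k: "k \<in> C" "enters f X k v n0" "t = time X n0"
    using E_first_SomeD[OF assms] .
  have "settled (max t (GST + \<rho>))" using settled_mono[OF settled_after_GST] by simp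
  thus "\<exists>n. time X n \<le> max t (GST + \<rho>) + 2 * \<delta> \<and> v \<le> view (st i (Suc n))" if "i \<in> C" for i
    using entered_reach[OF _ k(1,2) _ that] k(3) by (metis max.cobounded1)
qed (use assms in simp)

text \<open>By time \<open>t\<close> every correct process has left \<open>v\<close> and so wished
  for \<open>v + 1\<close>; with all these wishes at hand a single delay suffices instead of
  two.\<close>

lemma entry_after_leaving:
  assumes "E_first f C X (v + 1) \<noteq> None" "T_last f C X v = Some t" "settled s" "t \<le> s"
  shows "\<exists>l. E_last f C X (v + 1) = Some l \<and> l \<le> s + \<delta>"
proof (rule E_last_le[OF assms(1)])
  have "wished j (v + 1) s" if j: "j \<in> C" for j
  proof -
    obtain u where u: "T_proc f X j v = Some u"
      using assms(2) j unfolding T_last_def by (metis option.distinct(1) not_None_eq)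
    have "latest C (\<lambda>i. T_proc f X i v) = Some t"
      using assms(2) unfolding T_last_def by (auto split: if_splits)
    hence "u \<le> t" using latest_ge j u by metis
    thus ?thesis using left_wished[OF u] wished_mono assms(4) by (meson order_trans)
  qed
  thus "\<exists>n. time X n \<le> s + \<delta> \<and> v + 1 \<le> view (st i (Suc n))" if "i \<in> C" for i
    using all_wish_reach[OF assms(3), of "v + 1" i] that by (metis add_gr_0 zero_less_one)
qed

end

theorem theorem3:
  fixes f :: nat and C :: "'p::finite set" and GST \<delta> \<rho> :: real and X :: "'p trace"
  assumes "synchronizer_execution f C GST \<delta> \<rho> X"
    and "\<forall>i\<in>C. T_proc f X i 0 \<noteq> None"
  shows
    "(\<forall>i\<in>C. \<forall>v v' t t'. E_proc f X i v = Some t \<longrightarrow> E_proc f X i v' = Some t' \<longrightarrow>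
         (v < v' \<longleftrightarrow> t < t')) \<and>
     (\<forall>i\<in>C. \<forall>v t. E_proc f X i (v + 1) = Some t \<longrightarrow>
         (\<exists>a. A_first f C X v = Some a \<and> a < t)) \<and>
     (\<forall>v\<ge>threshold_view f C GST \<rho> X. \<forall>t. E_first f C X v = Some t \<longrightarrow>
         \<not> (\<exists>a. A_first f C X v = Some a \<and> a < t + 2 * \<delta>) \<longrightarrow>
         (\<forall>i\<in>C. E_proc f X i v \<noteq> None) \<and>
         (\<exists>l. E_last f C X v = Some l \<and> l \<le> t + 2 * \<delta>)) \<and>
     ((\<exists>P\<subseteq>C. card P = f + 1 \<and> (\<forall>i\<in>P. A_proc f X i 0 \<noteq> None)) \<longrightarrow>
         E_first f C X 1 \<noteq> None) \<and>
     (\<forall>v. E_first f C X v \<noteq> None \<longrightarrow>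
         (\<exists>P\<subseteq>C. card P = f + 1 \<and>
            (\<forall>i\<in>P. E_proc f X i v \<noteq> None \<longrightarrow> A_proc f X i v \<noteq> None)) \<longrightarrow>
         E_first f C X (v + 1) \<noteq> None) \<and>
     (\<forall>v t. E_first f C X v = Some t \<longrightarrow> early_start f C GST X \<longrightarrow>
         (\<exists>l. E_last f C X v = Some l \<and> l \<le> max t (GST + \<rho>) + 2 * \<delta>)) \<and>
     (\<forall>v. E_first f C X (v + 1) \<noteq> None \<longrightarrow>
         (\<exists>l. E_last f C X (v + 1) = Some l \<and>
            (\<forall>t. T_last f C X v = Some t \<longrightarrow>
               l \<le> (if early_start f C GST X then max t (GST + \<rho>) else t) + \<delta>)))"
proof -
  interpret synchronizer f C GST \<delta> \<rho> X by unfold_locales (rule assms(1))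
  have leaving: "\<exists>l. E_last f C X (v + 1) = Some l \<and> (\<forall>t. T_last f C X v = Some t \<longrightarrow>
      l \<le> (if early_start f C GST X then max t (GST + \<rho>) else t) + \<delta>)"
    if E: "E_first f C X (v + 1) \<noteq> None" for v
  proof -
    obtain l where l: "E_last f C X (v + 1) = Some l"
      using E entry_after_first by blast
    have "l \<le> (if early_start f C GST X then max t (GST + \<rho>) else t) + \<delta>"
      if T: "T_last f C X v = Some t" for t
    proof -
      \<comment> \<open>Settled in both cases: the first value is at least
        \<open>GST + \<rho>\<close>, and without an early start every time is settled.\<close>
      let ?s = "if early_start f C GST X then max t (GST + \<rho>) else t"
      have "settled ?s" using settled_mono[OF settled_after_GST] settled_late_start by simp
      from entry_after_leaving[OF E T this] l show ?thesis by simp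
    qed
    with l show ?thesis by blast
  qed
  show ?thesis
  proof (intro conjI, goal_cases)
    case 1
    show ?case using monotonicity by blast
  next
    case 2
    show ?case using validity by blast
  next
    case 3
    show ?case using bounded_entry by blast
  next
    case 4
    show ?case using startup[OF assms(2)] by blast
  next
    case 5
    show ?case using progress by blast
  next
    case 6
    show ?case using entry_after_first by blast
  next
    case 7
    show ?case using leaving by blast
  qed
qed

end
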